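(* Let $C$ be a nonempty closed convex subset of a uniformly convex partially ordered hyperbolic space $(E,\rho,\leq)$ and let $T:C\to C$ be a monotone generalized $\alpha$-nonexpansive mapping. Assume that there exist a bounded sequence $\{x_n\}_{n\in\mathbf{N}}\subset C$ and a point $x\in C$ such that either (i) $x_n\leq Tx_n$ and $x_n\leq x$ for all $n\in\mathbf{N}$, or (ii) $Tx_n\leq x_n$ and $x\leq x_n$ for all $n\in\mathbf{N}$. If $\liminf_{n\to\infty}\rho(x_n,Tx_n)=0$, then $T$ has a fixed point.
   Context: A hyperbolic metric space (hyperbolic space) is a metric space $(E,\rho)$ with a mapping $H:E\times E\times[0,1]\to E$, written $H(u,v,\beta)=(1-\beta)u\oplus\beta v$, such that for all $u,v,w,z\in E$ and $\beta,\gamma\in[0,1]$: (1) $\rho(z,H(u,v,\beta))\leq(1-\beta)\rho(z,u)+\beta\rho(z,v)$; (2) $\rho(H(u,v,\beta),H(u,v,\gamma))=|\beta-\gamma|\rho(u,v)$; (3) $H(u,v,\beta)=H(v,u,1-\beta)$; (4) $\rho(H(u,z,\beta),H(v,w,\beta))\leq(1-\beta)\rho(u,v)+\beta\rho(z,w)$. A subset $Y\subset E$ is convex if $(1-\beta)u\oplus\beta v\in Y$ for all $u,v\in Y$, $\beta\in[0,1]$. A partially ordered hyperbolic space $(E,\rho,\leq)$ is a hyperbolic space with a partial order $\leq$; throughout it is assumed that all order intervals $[a,\to)=\{u\in E: a\leq u\}$ and $(\leftarrow,b]=\{u\in E:u\leq b\}$ ($a,b\in E$) are closed and convex. For $r>0$,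 $\varepsilon\in(0,2]$ put $\delta(r,\varepsilon)=\inf\{1-\frac1r\rho(\frac12u\oplus\frac12v,a): a,u,v\in E,\ \rho(u,a)\leq r,\ \rho(v,a)\leq r,\ \rho(u,v)\geq r\varepsilon\}$. $E$ is uniformly convex if $\delta(r,\varepsilon)>0$ for all $r>0$, $\varepsilon\in(0,2]$. A mapping $T:C\to C$ is monotone if $Tx\leq Ty$ whenever $x,y\in C$, $x\leq y$. It is monotone generalized $\alpha$-nonexpansive if it is monotone and there is $\alpha\in[0,1)$ such that for all $x,y\in C$ with $x\leq y$: $\frac12\rho(x,Tx)\leq\rho(x,y)$ implies $\rho(Tx,Ty)\leq\alpha\rho(Tx,y)+\alpha\rho(x,Ty)+(1-2\alpha)\rho(x,y)$.
   Formalization: E is additionally assumed complete, and in case (ii) the generalized nonexpansiveness condition is also required for pairs x ≥ y (possibly with another α); without either assumption the statement is false. *)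

theory Defs
  imports "HOL-Analysis.Analysis"
begin

text \<open>The point \<open>(1 - \<beta>) u \<oplus> \<beta> v\<close> is written \<open>H u v \<beta>\<close>; the values of \<open>H\<close> for
  \<open>\<beta> \<notin> [0, 1]\<close> are unconstrained.\<close>

locale hyperbolic_space =
  fixes H :: "'a::metric_space \<Rightarrow> 'a \<Rightarrow> real \<Rightarrow> 'a"
  assumes dist_H_le:
      "\<beta> \<in> {0..1} \<Longrightarrow> dist z (H u v \<beta>) \<le> (1 - \<beta>) * dist z u + \<beta> * dist z v"
    and dist_H_H:
      "\<beta> \<in> {0..1} \<Longrightarrow> \<gamma> \<in> {0..1} \<Longrightarrow> dist (H u v \<beta>) (H u v \<gamma>) = \<bar>\<beta> - \<gamma>\<bar> * dist u v"
    and H_commute: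
      "\<beta> \<in> {0..1} \<Longrightarrow> H u v \<beta> = H v u (1 - \<beta>)"
    and dist_H_H_le:
      "\<beta> \<in> {0..1} \<Longrightarrow> dist (H u z \<beta>) (H v w \<beta>) \<le> (1 - \<beta>) * dist u v + \<beta> * dist z w"

definition hyp_convex :: "('a \<Rightarrow> 'a \<Rightarrow> real \<Rightarrow> 'a) \<Rightarrow> 'a set \<Rightarrow> bool" where
  "hyp_convex H Y \<longleftrightarrow> (\<forall>u\<in>Y. \<forall>v\<in>Y. \<forall>\<beta>\<in>{0..1}. H u v \<beta> \<in> Y)"

locale partially_ordered_hyperbolic_space = hyperbolic_space H
  for H :: "'a::{metric_space, order} \<Rightarrow> 'a \<Rightarrow> real \<Rightarrow> 'a" +
  assumes closed_upper: "closed {a :: 'a..}"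
    and closed_lower: "closed {..b :: 'a}"
    and convex_upper: "hyp_convex H {a..}"
    and convex_lower: "hyp_convex H {..b}"

text \<open>The infimum is taken in the extended reals, so that it is \<open>\<infinity>\<close> when no points
  \<open>a, u, v\<close> are admissible (as happens for large \<open>r\<close> in a bounded space).\<close>

definition convexity_modulus ::
    "('a::metric_space \<Rightarrow> 'a \<Rightarrow> real \<Rightarrow> 'a) \<Rightarrow> real \<Rightarrow> real \<Rightarrow> ereal" where
  "convexity_modulus H r \<epsilon> =
     Inf {ereal (1 - 1 / r * dist (H u v (1/2)) a) | a u v.
            dist u a \<le> r \<and> dist v a \<le> r \<and> dist u v \<ge> r * \<epsilon>}"

definition uniformly_convex :: "('a::metric_space \<Rightarrow> 'a \<Rightarrow> real \<Rightarrow> 'a) \<Rightarrow> bool" where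
  "uniformly_convex H \<longleftrightarrow> (\<forall>r>0. \<forall>\<epsilon>\<in>{0<..2}. convexity_modulus H r \<epsilon> > 0)"

text \<open>The antecedent is not symmetric in \<open>x\<close> and \<open>y\<close>, so the conditions for \<open>R = (\<le>)\<close> and
  \<open>R = (\<ge>)\<close> differ.\<close>

definition generalized_nonexpansive_wrt ::
    "('a::metric_space \<Rightarrow> 'a \<Rightarrow> bool) \<Rightarrow> 'a set \<Rightarrow> ('a \<Rightarrow> 'a) \<Rightarrow> bool" where
  "generalized_nonexpansive_wrt R C T \<longleftrightarrow>
     (\<exists>\<alpha>\<in>{0..<1::real}. \<forall>x\<in>C. \<forall>y\<in>C. R x y \<longrightarrow>
        1/2 * dist x (T x) \<le> dist x y \<longrightarrow>
        dist (T x) (T y)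
          \<le> \<alpha> * dist (T x) y + \<alpha> * dist x (T y) + (1 - 2 * \<alpha>) * dist x y)"

definition monotone_generalized_nonexpansive ::
    "'a::{metric_space, order} set \<Rightarrow> ('a \<Rightarrow> 'a) \<Rightarrow> bool" where
  "monotone_generalized_nonexpansive C T \<longleftrightarrow>
     mono_on C T \<and> generalized_nonexpansive_wrt (\<le>) C T"

end

theory Submission
  imports Defs
begin

text \<open>
  Pass to a subsequence with \<open>dist (xs n) (T (xs n)) \<longlonglongrightarrow> 0\<close>. In case (i) the points of \<open>C\<close> that
  lie above every \<open>xs n\<close> form a closed convex set \<open>K\<close>; it contains \<open>x\<close>, and \<open>T\<close> maps it into
  itself because \<open>xs n \<le> T (xs n) \<le> T y\<close> for \<open>y\<close> in \<open>K\<close>. Uniform convexity and completeness give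
  the sequence a unique asymptotic centre \<open>z\<close> in \<open>K\<close>, that is, a unique minimizer of
  \<open>y \<mapsto> limsup (dist (xs n) y)\<close> (\<open>asymptotic_center_exists\<close>). Nonexpansiveness in the form of
  \<open>dist_image_le\<close> says that \<open>T z\<close> is asymptotically no further from the sequence than \<open>z\<close> is, so
  \<open>T z = z\<close> by uniqueness.

  Two points need care. The modulus of convexity is only assumed positive at each radius
  separately, whereas the minimization works with radii decreasing to the asymptotic radius;
  contracting balls towards their centre shows that the modulus cannot degenerate from the right
  (\<open>midpoint_contraction\<close>). Moreover, \<open>dist_image_le\<close> is available for \<open>xs n\<close> and \<open>z\<close> only if
  \<open>1/2 * dist (xs n) (T (xs n)) \<le> dist (xs n) z\<close>. If this fails for infinitely many \<open>n\<close>, then both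
  \<open>xs n\<close> and \<open>T (xs n)\<close> accumulate at \<open>z\<close>, and \<open>z\<close> is fixed by an order argument
  (\<open>fixed_point_of_tendsto\<close>): closedness of order intervals gives \<open>z \<le> T z\<close>, while the images of
  points on the segment from \<open>z\<close> to \<open>T z\<close> lie above \<open>T z\<close> and tend to \<open>z\<close> as the points do, which
  gives \<open>T z \<le> z\<close>.

  Case (ii) is the same argument for the reversed order, so the order is kept as a parameter
  \<open>R\<close> until the end.
\<close>

section \<open>Asymptotic centres in uniformly convex hyperbolic spaces\<close>

lemma convexity_modulus_pos_midpoint:
  fixes H :: "'a::metric_space \<Rightarrow> 'a \<Rightarrow> real \<Rightarrow> 'a"
  assumes "uniformly_convex H" "r > 0" "\<epsilon> \<in> {0<..2}"
  obtains \<delta> where "\<delta> > 0"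
    "\<And>a u v :: 'a. dist u a \<le> r \<Longrightarrow> dist v a \<le> r \<Longrightarrow> dist u v \<ge> r * \<epsilon> \<Longrightarrow>
       dist (H u v (1/2)) a \<le> r * (1 - \<delta>)"
proof -
  have "convexity_modulus H r \<epsilon> > ereal 0"
    using assms by (auto simp: uniformly_convex_def zero_ereal_def)
  then obtain \<delta> where d: "ereal 0 < ereal \<delta>" "ereal \<delta> < convexity_modulus H r \<epsilon>"
    using ereal_dense2 by blast
  show thesis
  proof (rule that)
    show "\<delta> > 0" using d by simp
    fix a u v :: 'a assume "dist u a \<le> r" "dist v a \<le> r" "dist u v \<ge> r * \<epsilon>"
    then have "convexity_modulus H r \<epsilon> \<le> ereal (1 - 1 / r * dist (H u v (1/2)) a)"
      unfolding convexity_modulus_def by (intro Inf_lower) blast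
    then have "ereal \<delta> < ereal (1 - 1 / r * dist (H u v (1/2)) a)"
      using d(2) by (rule less_le_trans[rotated])
    then show "dist (H u v (1/2)) a \<le> r * (1 - \<delta>)"
      using \<open>r > 0\<close> by (simp add: field_simps)
  qed
qed

context hyperbolic_space
begin

lemma H_zero: "H u v 0 = u"
  using dist_H_le[of 0 u u v] by simp

lemma dist_H_left: "\<beta> \<in> {0..1} \<Longrightarrow> dist u (H u v \<beta>) = \<beta> * dist u v"
  using dist_H_H[of 0 \<beta> u v] by (simp add: H_zero)

text \<open>
  The same gain \<open>\<eta>\<close> works on all balls of radius up to \<open>r + \<eta>\<close>: moving \<open>u\<close> and \<open>v\<close> towards the
  centre \<open>a\<close> by the fraction \<open>\<eta> / (r + \<eta>)\<close> brings them into the ball of radius \<open>r\<close>, and displaces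
  \<open>u\<close>, \<open>v\<close> and their midpoint by at most \<open>\<eta>\<close>. At \<open>r = 0\<close> the hypotheses become contradictory.
\<close>
lemma midpoint_contraction:
  assumes uc: "uniformly_convex H" and r: "r \<ge> 0" and s: "s > 0"
  obtains \<eta> where "\<eta> > 0"
    "\<And>a u v. dist u a \<le> r + \<eta> \<Longrightarrow> dist v a \<le> r + \<eta> \<Longrightarrow> dist u v \<ge> s \<Longrightarrow>
       dist (H u v (1/2)) a \<le> r - \<eta>"
proof (cases "r = 0")
  case True
  show thesis
  proof (rule that[of "s / 3"])
    show "s / 3 > 0" using s by simp
    fix a u v :: 'a
    assume "dist u a \<le> r + s / 3" "dist v a \<le> r + s / 3" "dist u v \<ge> s"
    then show "dist (H u v (1/2)) a \<le> r - s / 3"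
      using True s dist_triangle2[of u v a] by simp
  qed
next
  case False
  then have r0: "r > 0" using r by simp
  define s' where "s' = min s r"
  define \<epsilon> where "\<epsilon> = s' / (2 * r)"
  have s': "0 < s'" "s' \<le> s" "s' \<le> r" using s r0 by (auto simp: s'_def)
  have "\<epsilon> \<in> {0<..2}" using s' r0 by (simp add: \<epsilon>_def field_simps)
  then obtain \<delta> where \<delta>: "\<delta> > 0"
    "\<And>a u v. dist u a \<le> r \<Longrightarrow> dist v a \<le> r \<Longrightarrow> dist u v \<ge> r * \<epsilon> \<Longrightarrow>
       dist (H u v (1/2)) a \<le> r * (1 - \<delta>)"
    using convexity_modulus_pos_midpoint[OF uc r0] by blast
  define \<eta> where "\<eta> = min (s' / 4) (r * \<delta> / 2)"
  have \<eta>: "\<eta> > 0" "4 * \<eta> \<le> s'" "2 * \<eta> \<le> r * \<delta>"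
    using s' r0 \<delta>(1) min.cobounded1[of "s' / 4" "r * \<delta> / 2"] min.cobounded2[of "s' / 4" "r * \<delta> / 2"]
    unfolding \<eta>_def by auto
  define t where "t = \<eta> / (r + \<eta>)"
  have t: "t \<in> {0..1}" "(1 - t) * (r + \<eta>) = r" "t * (r + \<eta>) = \<eta>"
    using r0 \<eta>(1) by (auto simp: t_def field_simps)
  have pull: "dist (H w a t) a \<le> r" "dist w (H w a t) \<le> \<eta>" if "dist w a \<le> r + \<eta>" for w a
  proof -
    have "dist (H w a t) a \<le> (1 - t) * dist w a"
      using dist_H_le[OF t(1), of a w a] by (simp add: dist_commute)
    also have "\<dots> \<le> r" using mult_left_mono[OF that, of "1 - t"] t by simp
    finally show "dist (H w a t) a \<le> r" .
    have "dist w (H w a t) = t * dist w a" by (rule dist_H_left[OF t(1)])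
    also have "\<dots> \<le> \<eta>" using mult_left_mono[OF that, of t] t by simp
    finally show "dist w (H w a t) \<le> \<eta>" .
  qed
  show thesis
  proof (rule that[OF \<eta>(1)])
    fix a u v :: 'a assume uv: "dist u a \<le> r + \<eta>" "dist v a \<le> r + \<eta>" "dist u v \<ge> s"
    let ?u = "H u a t" and ?v = "H v a t"
    have "dist u v \<le> dist u ?u + dist ?u ?v + dist v ?v"
      using dist_triangle[of u v ?u] dist_triangle2[of ?u v ?v] by simp
    then have "dist ?u ?v \<ge> s' / 2"
      using pull(2)[OF uv(1)] pull(2)[OF uv(2)] uv(3) s' \<eta>(2) by simp
    then have "dist ?u ?v \<ge> r * \<epsilon>" using r0 by (simp add: \<epsilon>_def)
    then have mid: "dist (H ?u ?v (1/2)) a \<le> r * (1 - \<delta>)"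
      using \<delta>(2) pull(1) uv by blast
    have "dist (H u v (1/2)) (H ?u ?v (1/2)) \<le> 1/2 * dist u ?u + 1/2 * dist v ?v"
      using dist_H_H_le[of "1/2" u v ?u ?v] by simp
    also have "\<dots> \<le> \<eta>" using pull(2)[OF uv(1)] pull(2)[OF uv(2)] by simp
    finally have "dist (H u v (1/2)) a \<le> \<eta> + r * (1 - \<delta>)"
      using mid dist_triangle[of "H u v (1/2)" a "H ?u ?v (1/2)"] by simp
    then show "dist (H u v (1/2)) a \<le> r - \<eta>"
      using \<eta>(3) by (simp add: algebra_simps)
  qed
qed

text \<open>
  If two points of \<open>K\<close> are both nearly optimal for \<open>limsup (dist (xs n) y)\<close> but far apart, their
  midpoint beats the infimum. So minimizing sequences are Cauchy, and the minimizer \<open>z\<close> is unique.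
  The second conclusion expresses minimality and uniqueness together, without mentioning the limsup:
  no other point of \<open>K\<close> is, up to any \<open>\<eta> > 0\<close>, eventually as close to the sequence as \<open>z\<close> is.
\<close>
lemma asymptotic_center_exists:
  fixes xs :: "nat \<Rightarrow> 'a"
  assumes uc: "uniformly_convex H" and compl: "complete (UNIV :: 'a set)"
    and K: "K \<noteq> {}" "closed K" "hyp_convex H K" and bdd: "bounded (range xs)"
  obtains z where "z \<in> K"
    "\<And>w. w \<in> K \<Longrightarrow> (\<And>\<eta>. \<eta> > 0 \<Longrightarrow> \<forall>\<^sub>F n in sequentially. dist (xs n) w \<le> dist (xs n) z + \<eta>)
       \<Longrightarrow> w = z"
proof -
  define S where "S = {\<rho>. \<exists>y\<in>K. \<forall>\<^sub>F n in sequentially. dist (xs n) y \<le> \<rho>}"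
  \<comment> \<open>the asymptotic radius of the sequence in \<open>K\<close>\<close>
  define r where "r = Inf S"
  have S_nonneg: "\<rho> \<ge> 0" if \<rho>: "\<rho> \<in> S" for \<rho>
  proof -
    obtain y where "\<forall>\<^sub>F n in sequentially. dist (xs n) y \<le> \<rho>" using \<rho> by (auto simp: S_def)
    then obtain n where "dist (xs n) y \<le> \<rho>" by (auto simp: eventually_sequentially)
    then show ?thesis using zero_le_dist[of "xs n" y] by linarith
  qed
  then have S_below: "bdd_below S" by (intro bdd_belowI)
  have "S \<noteq> {}"
  proof -
    obtain y where "y \<in> K" using K by blast
    moreover obtain e where "\<And>n. dist (xs n) y \<le> e"
      using bdd bounded_any_center[of "range xs" y] by (auto simp: dist_commute)
    ultimately have "e \<in> S"
      unfolding S_def by (blast intro: always_eventually)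
    then show ?thesis by blast
  qed
  then have r_nonneg: "r \<ge> 0" unfolding r_def using S_nonneg by (rule cInf_greatest)
  have near: "\<exists>y\<in>K. \<forall>\<^sub>F n in sequentially. dist (xs n) y \<le> r + \<eta>" if "\<eta> > 0" for \<eta>
  proof -
    have "Inf S < r + \<eta>" using that by (simp add: r_def)
    then obtain \<rho> where "\<rho> \<in> S" "\<rho> < r + \<eta>"
      using cInf_lessD[OF \<open>S \<noteq> {}\<close>] by blast
    then obtain y where "y \<in> K" "\<forall>\<^sub>F n in sequentially. dist (xs n) y \<le> \<rho>"
      by (auto simp: S_def)
    moreover from this(2) have "\<forall>\<^sub>F n in sequentially. dist (xs n) y \<le> r + \<eta>"
      by eventually_elim (use \<open>\<rho> < r + \<eta>\<close> in simp)
    ultimately show ?thesis by blast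
  qed
  have close: "\<exists>\<eta>>0. \<forall>y\<in>K. \<forall>y'\<in>K. (\<forall>\<^sub>F n in sequentially. dist (xs n) y \<le> r + \<eta>) \<longrightarrow>
      (\<forall>\<^sub>F n in sequentially. dist (xs n) y' \<le> r + \<eta>) \<longrightarrow> dist y y' < s" if s: "s > 0" for s
  proof -
    obtain \<eta> where \<eta>: "\<eta> > 0"
      "\<And>a u v. dist u a \<le> r + \<eta> \<Longrightarrow> dist v a \<le> r + \<eta> \<Longrightarrow> dist u v \<ge> s \<Longrightarrow>
         dist (H u v (1/2)) a \<le> r - \<eta>"
      using midpoint_contraction[OF uc r_nonneg s] by blast
    have "dist y y' < s" if y: "y \<in> K" "y' \<in> K"
      and ev: "\<forall>\<^sub>F n in sequentially. dist (xs n) y \<le> r + \<eta>"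
        "\<forall>\<^sub>F n in sequentially. dist (xs n) y' \<le> r + \<eta>" for y y'
    proof (rule ccontr)
      assume "\<not> dist y y' < s"
      then have far: "dist y y' \<ge> s" by simp
      from ev have "\<forall>\<^sub>F n in sequentially. dist (xs n) (H y y' (1/2)) \<le> r - \<eta>"
      proof eventually_elim
        case (elim n)
        then show ?case using \<eta>(2)[of y "xs n" y'] far by (simp add: dist_commute)
      qed
      moreover have "H y y' (1/2) \<in> K" using K(3) y by (auto simp: hyp_convex_def)
      ultimately have "r - \<eta> \<in> S" unfolding S_def by blast
      then have "r \<le> r - \<eta>" unfolding r_def using S_below by (rule cInf_lower)
      then show False using \<eta>(1) by simp
    qed
    then show ?thesis using \<eta>(1) by blast
  qed
  obtain y where y: "\<And>k. y k \<in> K"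
    "\<And>k. \<forall>\<^sub>F n in sequentially. dist (xs n) (y k) \<le> r + inverse (real (Suc k))"
  proof -
    have "\<exists>y\<in>K. \<forall>\<^sub>F n in sequentially. dist (xs n) y \<le> r + inverse (real (Suc k))" for k
      by (rule near) simp
    then show thesis using that by metis
  qed
  have y_near: "\<exists>N. \<forall>k\<ge>N. \<forall>\<^sub>F n in sequentially. dist (xs n) (y k) \<le> r + \<eta>" if \<eta>: "\<eta> > 0" for \<eta>
  proof -
    obtain N where N: "inverse (real (Suc N)) < \<eta>" using reals_Archimedean[OF \<eta>] by blast
    have "\<forall>\<^sub>F n in sequentially. dist (xs n) (y k) \<le> r + \<eta>" if "k \<ge> N" for k
    proof -
      have "inverse (real (Suc k)) \<le> inverse (real (Suc N))" using that by simp
      with N have "inverse (real (Suc k)) \<le> \<eta>" by linarith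
      with y(2)[of k] show ?thesis by (fastforce elim: eventually_mono)
    qed
    then show ?thesis by blast
  qed
  have "Cauchy y"
  proof (rule metric_CauchyI)
    fix s :: real assume "s > 0"
    from close[OF this] obtain \<eta> where "\<eta> > 0"
      "\<And>u v. u \<in> K \<Longrightarrow> v \<in> K \<Longrightarrow> \<forall>\<^sub>F n in sequentially. dist (xs n) u \<le> r + \<eta> \<Longrightarrow>
        \<forall>\<^sub>F n in sequentially. dist (xs n) v \<le> r + \<eta> \<Longrightarrow> dist u v < s" by blast
    with y_near[OF this(1)] y(1) show "\<exists>M. \<forall>m\<ge>M. \<forall>n\<ge>M. dist (y m) (y n) < s" by meson
  qed
  then obtain z where z: "y \<longlonglongrightarrow> z" using compl by (auto simp: complete_def)
  have zK: "z \<in> K" using closed_sequentially[OF K(2) _ z] y(1) by blast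
  have z_near: "\<forall>\<^sub>F n in sequentially. dist (xs n) z \<le> r + \<eta>" if \<eta>: "\<eta> > 0" for \<eta>
  proof -
    obtain N where N: "\<And>k. k \<ge> N \<Longrightarrow> \<forall>\<^sub>F n in sequentially. dist (xs n) (y k) \<le> r + \<eta> / 2"
      using y_near[of "\<eta> / 2"] \<eta> by auto
    obtain M where M: "\<And>k. k \<ge> M \<Longrightarrow> dist (y k) z < \<eta> / 2"
      using metric_LIMSEQ_D[OF z, of "\<eta> / 2"] \<eta> by auto
    let ?k = "max M N"
    have "\<forall>\<^sub>F n in sequentially. dist (xs n) (y ?k) \<le> r + \<eta> / 2" by (rule N) simp
    then show ?thesis
    proof eventually_elim
      case (elim n)
      then show ?case using M[of ?k] dist_triangle[of "xs n" z "y ?k"] by simp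
    qed
  qed
  show thesis
  proof (rule that[OF zK])
    fix w assume w: "w \<in> K"
      "\<And>\<eta>. \<eta> > 0 \<Longrightarrow> \<forall>\<^sub>F n in sequentially. dist (xs n) w \<le> dist (xs n) z + \<eta>"
    have w_near: "\<forall>\<^sub>F n in sequentially. dist (xs n) w \<le> r + \<eta>" if \<eta>: "\<eta> > 0" for \<eta>
    proof -
      have h: "\<eta> / 2 > 0" using \<eta> by simp
      show ?thesis using w(2)[OF h] z_near[OF h] by eventually_elim simp
    qed
    have "dist w z < s" if s: "s > 0" for s
      using close[OF s] w(1) zK w_near z_near by blast
    then show "w = z" using zero_less_dist_iff[of w z] less_irrefl by blast
  qed
qed

end

section \<open>Monotone generalized nonexpansive maps\<close>

text \<open>
  The order is a relation \<open>R\<close> rather than a type class operation, so that a single development can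
  be instantiated with both \<open>(\<le>)\<close> and \<open>(\<ge>)\<close> on the same type.
\<close>
locale monotone_nonexpansive_map = hyperbolic_space H
  for H :: "'a::metric_space \<Rightarrow> 'a \<Rightarrow> real \<Rightarrow> 'a" +
  fixes R :: "'a \<Rightarrow> 'a \<Rightarrow> bool" and C :: "'a set" and T :: "'a \<Rightarrow> 'a"
  assumes R_refl: "R a a"
    and R_trans: "R a b \<Longrightarrow> R b c \<Longrightarrow> R a c"
    and R_antisym: "R a b \<Longrightarrow> R b a \<Longrightarrow> a = b"
    and closed_above: "closed {y. R a y}"
    and closed_below: "closed {y. R y b}"
    and convex_above: "hyp_convex H {y. R a y}"
    and closed_C: "closed C" and convex_C: "hyp_convex H C"
    and T_into: "T \<in> C \<rightarrow> C"
    and T_mono: "a \<in> C \<Longrightarrow> b \<in> C \<Longrightarrow> R a b \<Longrightarrow> R (T a) (T b)"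
    and nonexpansive: "generalized_nonexpansive_wrt R C T"
begin

text \<open>
  The term \<open>\<alpha> * dist (T x) y\<close> is absorbed by the triangle inequality into
  \<open>\<alpha> * dist x y\<close>, which leaves the weight \<open>1 - \<alpha>\<close> on \<open>dist x y\<close>. This weight is positive even when
  \<open>1 - 2 * \<alpha>\<close> is not. The constant obtained is \<open>(1 + \<alpha>) / (1 - \<alpha>)\<close>.
\<close>
lemma dist_image_le:
  obtains c where
    "\<And>x y. x \<in> C \<Longrightarrow> y \<in> C \<Longrightarrow> R x y \<Longrightarrow> 1/2 * dist x (T x) \<le> dist x y \<Longrightarrow>
       dist x (T y) \<le> dist x y + c * dist x (T x)"
proof -
  obtain \<alpha> where \<alpha>: "0 \<le> \<alpha>" "\<alpha> < 1"
    and ne: "\<And>x y. x \<in> C \<Longrightarrow> y \<in> C \<Longrightarrow> R x y \<Longrightarrow> 1/2 * dist x (T x) \<le> dist x y \<Longrightarrow>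
      dist (T x) (T y) \<le> \<alpha> * dist (T x) y + \<alpha> * dist x (T y) + (1 - 2 * \<alpha>) * dist x y"
    using nonexpansive unfolding generalized_nonexpansive_wrt_def by fastforce
  show thesis
  proof (rule that)
    fix x y assume xy: "x \<in> C" "y \<in> C" "R x y" "1/2 * dist x (T x) \<le> dist x y"
    have "\<alpha> * dist (T x) y \<le> \<alpha> * (dist x (T x) + dist x y)"
      using \<alpha>(1) dist_triangle3[of "T x" y x] by (intro mult_left_mono) auto
    moreover have "dist x (T y) \<le> dist x (T x) + dist (T x) (T y)"
      by (rule dist_triangle)
    ultimately have "(1 - \<alpha>) * dist x (T y) \<le> (1 - \<alpha>) * dist x y + (1 + \<alpha>) * dist x (T x)"
      using ne[OF xy] by (simp add: algebra_simps)
    then show "dist x (T y) \<le> dist x y + ((1 + \<alpha>) / (1 - \<alpha>)) * dist x (T x)"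
      using \<alpha>(2) by (simp add: field_simps)
  qed
qed

text \<open>
  Monotonicity and closedness of \<open>{y. R y (T z)}\<close> give \<open>R z (T z)\<close>, so the segment from \<open>z\<close> to \<open>T z\<close>
  lies above \<open>z\<close>. If \<open>T z \<noteq> z\<close>, a point \<open>y \<noteq> z\<close> of this segment has positive distance from the limit
  \<open>z\<close> of \<open>xs i\<close>, whereas \<open>dist (xs i) (T (xs i))\<close> tends to \<open>0\<close>; so \<open>dist_image_le\<close> eventually
  applies to \<open>xs i\<close> and \<open>y\<close>, and in the limit it reads \<open>dist z (T y) \<le> dist z y\<close>. As \<open>y\<close> tends to \<open>z\<close>, the points \<open>T y\<close>
  tend to \<open>z\<close> from above \<open>T z\<close>, so \<open>R (T z) z\<close>.
\<close>
lemma fixed_point_of_tendsto: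
  assumes F: "F \<noteq> bot" and lim: "(xs \<longlongrightarrow> z) F" "((\<lambda>i. T (xs i)) \<longlongrightarrow> z) F"
    and xs: "\<And>i. xs i \<in> C" "\<And>i. R (xs i) z" and z: "z \<in> C"
  shows "T z = z"
proof (rule ccontr)
  assume "T z \<noteq> z"
  then have d: "dist z (T z) > 0" by auto
  have TzC: "T z \<in> C" using T_into z by blast
  have "R (T (xs i)) (T z)" for i using T_mono xs z by blast
  then have zTz: "R z (T z)"
    using Lim_in_closed_set[OF closed_below _ F lim(2), of "T z"] by simp
  obtain c where c: "\<And>x y. x \<in> C \<Longrightarrow> y \<in> C \<Longrightarrow> R x y \<Longrightarrow> 1/2 * dist x (T x) \<le> dist x y \<Longrightarrow>
       dist x (T y) \<le> dist x y + c * dist x (T x)"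
    using dist_image_le by blast
  define y where "y k = H z (T z) (inverse (real (Suc k)))" for k
  have \<beta>: "inverse (real (Suc k)) \<in> {0..1}" for k by (simp add: field_simps)
  have yC: "y k \<in> C" for k
    using convex_C z TzC \<beta> unfolding hyp_convex_def y_def by blast
  have zy: "R z (y k)" for k
    using convex_above[of z] R_refl[of z] zTz \<beta>[of k] unfolding hyp_convex_def y_def by blast
  have dist_y: "dist z (y k) = inverse (real (Suc k)) * dist z (T z)" for k
    unfolding y_def by (rule dist_H_left[OF \<beta>])
  have lim_T: "((\<lambda>i. dist (xs i) (T (xs i))) \<longlongrightarrow> 0) F"
    using tendsto_dist[OF lim] by simp
  have Ty_near: "dist z (T (y k)) \<le> dist z (y k)" for k
  proof (rule tendsto_le[OF F])
    show "((\<lambda>i. dist (xs i) (T (y k))) \<longlongrightarrow> dist z (T (y k))) F"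
      by (intro tendsto_intros lim)
    have "((\<lambda>i. dist (xs i) (y k) + c * dist (xs i) (T (xs i))) \<longlongrightarrow> dist z (y k) + c * 0) F"
      by (intro tendsto_intros lim lim_T)
    then show "((\<lambda>i. dist (xs i) (y k) + c * dist (xs i) (T (xs i))) \<longlongrightarrow> dist z (y k)) F"
      by simp
    have "((\<lambda>i. dist (xs i) (y k) - 1/2 * dist (xs i) (T (xs i))) \<longlongrightarrow> dist z (y k) - 1/2 * 0) F"
      by (intro tendsto_intros lim lim_T)
    moreover have "dist z (y k) > 0" using d by (simp add: dist_y)
    ultimately have
      "\<forall>\<^sub>F i in F. 0 < dist (xs i) (y k) - 1/2 * dist (xs i) (T (xs i))"
      by (intro order_tendstoD(1)) auto
    then show "\<forall>\<^sub>F i in F. dist (xs i) (T (y k)) \<le> dist (xs i) (y k) + c * dist (xs i) (T (xs i))"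
    proof eventually_elim
      case (elim i)
      show ?case by (rule c[OF xs(1) yC R_trans[OF xs(2) zy]]) (use elim in simp)
    qed
  qed
  have "(\<lambda>k. dist z (T (y k))) \<longlonglongrightarrow> 0"
  proof (rule tendsto_sandwich[OF _ _ tendsto_const])
    show "(\<lambda>k. dist z (y k)) \<longlonglongrightarrow> 0"
      unfolding dist_y using tendsto_mult_right[OF LIMSEQ_inverse_real_of_nat, of "dist z (T z)"]
      by simp
  qed (simp_all add: Ty_near)
  then have "(\<lambda>k. T (y k)) \<longlonglongrightarrow> z"
    by (simp add: tendsto_dist_iff[of _ z] dist_commute)
  moreover have "R (T z) (T (y k))" for k using T_mono z yC zy by blast
  ultimately have "R (T z) z"
    using Lim_in_closed_set[OF closed_above, of "\<lambda>k. T (y k)" "T z" sequentially z] by simp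
  then show False using R_antisym zTz \<open>T z \<noteq> z\<close> by blast
qed

text \<open>
  The asymptotic centre \<open>z\<close> is taken relative to the set \<open>K\<close> of upper bounds of the sequence, because
  \<open>dist_image_le\<close> compares only related points. It is fixed in either case: by uniqueness of the
  centre if the premise of \<open>dist_image_le\<close> eventually holds for \<open>xs n\<close> and \<open>z\<close>, and otherwise by
  \<open>fixed_point_of_tendsto\<close>.
\<close>
lemma fixed_point_of_approximate_fixed_points:
  assumes uc: "uniformly_convex H" and compl: "complete (UNIV :: 'a set)"
    and xs: "\<And>n. xs n \<in> C" "\<And>n. R (xs n) (T (xs n))" "\<And>n. R (xs n) x"
    and x: "x \<in> C" and bdd: "bounded (range xs)"
    and lim: "(\<lambda>n. dist (xs n) (T (xs n))) \<longlonglongrightarrow> 0"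
  shows "\<exists>p\<in>C. T p = p"
proof -
  define K where "K = C \<inter> (\<Inter>n. {y. R (xs n) y})"
  have "x \<in> K" using x xs by (simp add: K_def)
  then have "K \<noteq> {}" by blast
  moreover have "closed K" unfolding K_def by (intro closed_Int closed_INT ballI closed_C closed_above)
  moreover have "hyp_convex H K"
    using convex_C convex_above unfolding hyp_convex_def K_def
    by (auto simp del: atLeastAtMost_iff)
  ultimately obtain z where z: "z \<in> K" and center:
    "\<And>w. w \<in> K \<Longrightarrow> (\<And>\<eta>. \<eta> > 0 \<Longrightarrow> \<forall>\<^sub>F n in sequentially. dist (xs n) w \<le> dist (xs n) z + \<eta>)
       \<Longrightarrow> w = z"
    using asymptotic_center_exists[OF uc compl _ _ _ bdd] by blast
  have zC: "z \<in> C" and xz: "R (xs n) z" for n using z by (auto simp: K_def)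
  have "T z = z"
  proof (cases "\<forall>\<^sub>F n in sequentially. 1/2 * dist (xs n) (T (xs n)) \<le> dist (xs n) z")
    case True
    obtain c where c: "\<And>x y. x \<in> C \<Longrightarrow> y \<in> C \<Longrightarrow> R x y \<Longrightarrow> 1/2 * dist x (T x) \<le> dist x y \<Longrightarrow>
         dist x (T y) \<le> dist x y + c * dist x (T x)"
      using dist_image_le by blast
    have "R (xs n) (T z)" for n using R_trans[OF xs(2) T_mono[OF xs(1) zC xz]] .
    then have "T z \<in> K" using T_into zC by (auto simp: K_def)
    then show ?thesis
    proof (rule center)
      fix \<eta> :: real assume "\<eta> > 0"
      moreover have "(\<lambda>n. c * dist (xs n) (T (xs n))) \<longlonglongrightarrow> 0"
        using tendsto_mult_left[OF lim, of c] by simp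
      ultimately have "\<forall>\<^sub>F n in sequentially. c * dist (xs n) (T (xs n)) < \<eta>"
        by (rule order_tendstoD(2)[rotated])
      then show "\<forall>\<^sub>F n in sequentially. dist (xs n) (T z) \<le> dist (xs n) z + \<eta>"
        using True
      proof eventually_elim
        case (elim n)
        then show ?case using c[OF xs(1) zC xz, of n] by simp
      qed
    qed
  next
    case False
    let ?A = "{n. dist (xs n) z < 1/2 * dist (xs n) (T (xs n))}"
    \<comment> \<open>convergence along \<open>F\<close> is convergence along the infinitely many exceptional indices\<close>
    define F where "F = inf sequentially (principal ?A)"
    have F: "F \<noteq> bot"
      using False by (simp add: F_def trivial_limit_def eventually_inf_principal not_less)
    have lim_F: "((\<lambda>n. dist (xs n) (T (xs n))) \<longlongrightarrow> 0) F"
      using lim by (rule tendsto_mono[rotated]) (simp add: F_def)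
    have "((\<lambda>n. dist (xs n) z) \<longlongrightarrow> 0) F"
    proof (rule tendsto_sandwich[OF _ _ tendsto_const])
      show "((\<lambda>n. 1/2 * dist (xs n) (T (xs n))) \<longlongrightarrow> 0) F"
        using tendsto_mult_left[OF lim_F, of "1/2"] by simp
      show "\<forall>\<^sub>F n in F. dist (xs n) z \<le> 1/2 * dist (xs n) (T (xs n))"
        by (simp add: F_def eventually_inf_principal)
    qed simp
    then have lim_xs: "(xs \<longlongrightarrow> z) F" by (simp add: tendsto_dist_iff[of xs])
    have "((\<lambda>n. dist (T (xs n)) z) \<longlongrightarrow> 0) F"
    proof (rule tendsto_sandwich[OF _ _ tendsto_const])
      show "((\<lambda>n. dist (xs n) (T (xs n)) + dist (xs n) z) \<longlongrightarrow> 0) F"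
        using tendsto_add[OF lim_F \<open>((\<lambda>n. dist (xs n) z) \<longlongrightarrow> 0) F\<close>] by simp
      show "\<forall>\<^sub>F n in F. dist (T (xs n)) z \<le> dist (xs n) (T (xs n)) + dist (xs n) z"
        by (intro always_eventually allI dist_triangle3)
    qed simp
    then have "((\<lambda>n. T (xs n)) \<longlongrightarrow> z) F" by (simp add: tendsto_dist_iff[of "\<lambda>n. T (xs n)"])
    then show ?thesis using fixed_point_of_tendsto[OF F lim_xs] xs(1) xz zC by blast
  qed
  then show ?thesis using zC by blast
qed

end

section \<open>The fixed point theorem\<close>

theorem theorem1:
  fixes H :: "'a::{metric_space, order} \<Rightarrow> 'a \<Rightarrow> real \<Rightarrow> 'a"
    and C :: "'a set" and T :: "'a \<Rightarrow> 'a"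
    and xs :: "nat \<Rightarrow> 'a" and x :: 'a
  assumes "partially_ordered_hyperbolic_space H"
    and "complete (UNIV :: 'a set)"
    and "uniformly_convex H"
    and "C \<noteq> {}" and "closed C" and "hyp_convex H C"
    and "T \<in> C \<rightarrow> C"
    and "monotone_generalized_nonexpansive C T"
    and "range xs \<subseteq> C" and "bounded (range xs)" and "x \<in> C"
    and "(\<forall>n. xs n \<le> T (xs n) \<and> xs n \<le> x) \<or>
         (\<forall>n. T (xs n) \<le> xs n \<and> x \<le> xs n) \<and> generalized_nonexpansive_wrt (\<ge>) C T"
    and "liminf (\<lambda>n. ereal (dist (xs n) (T (xs n)))) = 0"
  shows "\<exists>p\<in>C. T p = p"
proof -
  interpret partially_ordered_hyperbolic_space H by fact
  have mono: "mono_on C T" and ne: "generalized_nonexpansive_wrt (\<le>) C T"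
    using assms(8) by (auto simp: monotone_generalized_nonexpansive_def)
  obtain k :: "nat \<Rightarrow> nat" where
    "((\<lambda>n. ereal (dist (xs n) (T (xs n)))) \<circ> k) \<longlonglongrightarrow> 0"
    using liminf_subseq_lim[of "\<lambda>n. ereal (dist (xs n) (T (xs n)))"] assms(13) by auto
  then have lim: "(\<lambda>n. dist (xs (k n)) (T (xs (k n)))) \<longlonglongrightarrow> 0"
    by (simp add: o_def zero_ereal_def)
  have bdd: "bounded (range (\<lambda>n. xs (k n)))"
    using assms(10) by (rule bounded_subset) auto
  have xs: "xs n \<in> C" for n using assms(9) by blast
  from assms(12) show ?thesis
  proof (elim disjE conjE)
    assume above: "\<forall>n. xs n \<le> T (xs n) \<and> xs n \<le> x"
    interpret monotone_nonexpansive_map H "(\<le>)" C T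
      by unfold_locales
        (use assms(5-7) mono ne closed_upper closed_lower convex_upper in
          \<open>auto simp: atLeast_def atMost_def mono_on_def\<close>)
    show ?thesis
      by (rule fixed_point_of_approximate_fixed_points[OF assms(3,2) _ _ _ assms(11) bdd lim])
        (use xs above in auto)
  next
    assume below: "\<forall>n. T (xs n) \<le> xs n \<and> x \<le> xs n"
      and ne': "generalized_nonexpansive_wrt (\<ge>) C T"
    interpret monotone_nonexpansive_map H "(\<ge>)" C T
      by unfold_locales
        (use assms(5-7) mono ne' closed_upper closed_lower convex_lower in
          \<open>auto simp: atLeast_def atMost_def mono_on_def\<close>)
    show ?thesis
      by (rule fixed_point_of_approximate_fixed_points[OF assms(3,2) _ _ _ assms(11) bdd lim])
        (use xs below in auto)
  qed
qed

end
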